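(* For every atomic base $\mathfrak{B}$: if for all finite sets of formulas $\Gamma$ and all formulas $A$ we have $(\Gamma \models^{s}_{\mathfrak{B}} A \Longrightarrow \Gamma \models^{\alpha}_{\mathfrak{B}} A)$, then for all finite sets of formulas $\Gamma$ and all formulas $A$ we have $(\Gamma \models^{\alpha}_{\mathfrak{B}} A \Longrightarrow \Gamma \models^{s}_{\mathfrak{B}} A)$. Here $\models^{s}_{\mathfrak{B}}$ is consequence over $\mathfrak{B}$ in the non-monotonic version of Sandqvist's base semantics and $\models^{\alpha}_{\mathfrak{B}}$ is consequence over $\mathfrak{B}$ in non-monotonic reducibility semantics.
   Context: **Language.** Formulas: $X ::= p, q, r, s, t, \ldots \mid \bot \mid X \wedge X \mid X \vee X \mid X \rightarrow X$, with $\neg X := X \rightarrow \bot$. Atomic formulas (atoms) are the propositional variables and $\bot$ (an atomic constant for absurdity). $\Gamma$ always denotes a finite set of formulas. **Atomic bases.** Every atom is an atomic rule of level $0$. Given atoms $A_1,\ldots,A_n$ and (possibly empty) finite sets of atomic rules $\mathfrak{C}_1,\ldots,\mathfrak{C}_n$, where the rules "from $\mathfrak{C}_i$ infer $A_i$" have maximal level $k-1$ (if $\mathfrak{C}_i=\emptyset$, this is just the atom $A_i$, of level $0$), and given an atom $A$, the rule with premises $A_1,\ldots,A_n$, conclusion $A$, and discharging $\mathfrak{C}_i$ above the $i$-th premise, is an atomic rule of level $k$. An atomic base of level $k$ is a set of atomic rules of maximal level $k$; there is no upper bound on the admitted levels $k$. Derivations are the usual natural deduction trees: an atom $A$ is derivable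 from a set of rules $\mathfrak{S}$ when some rule in $\mathfrak{S}$ has conclusion $A$ and each premise $A_i$ of it is derivable from $\mathfrak{S} \cup \mathfrak{C}_i$, $\mathfrak{C}_i$ being the set of rules discharged at that premise (an atom in $\mathfrak{S}$ is derivable outright). $\mathrm{DER}_{\mathfrak{B}}$ is the set of derivations over $\mathfrak{B}$, and $\vdash_{\mathfrak{B}} A$ means that $A$ is derivable from $\mathfrak{B}$. All atomic bases $\mathfrak{B}$ are assumed consistent: $\not\vdash_{\mathfrak{B}} \bot$. **Sandqvist's base semantics (non-monotonic).** $\Gamma \models^{s}_{\mathfrak{B}} A$ is defined by: if $\Gamma = \emptyset$, then for $A$ atomic, $\models^{s}_{\mathfrak{B}} A$ iff $\vdash_{\mathfrak{B}} A$; $\models^{s}_{\mathfrak{B}} A \wedge B$ iff $\models^{s}_{\mathfrak{B}} A$ and $\models^{s}_{\mathfrak{B}} B$; $\models^{s}_{\mathfrak{B}} A \vee B$ iff for every atom $C$ (if $A \models^{s}_{\mathfrak{B}} C$ and $B \models^{s}_{\mathfrak{B}} C$, then $\models^{s}_{\mathfrak{B}} C$); $\models^{s}_{\mathfrak{B}} A \rightarrow B$ iff $A \models^{s}_{\mathfrak{B}} B$. If $\Gamma \neq \emptyset$, then $\Gamma \models^{s}_{\mathfrak{B}} A$ iff ($\models^{s}_{\mathfrak{B}} B$ for all $B \in \Gamma$ implies $\models^{s}_{\mathfrak{B}} A$). **Reducibility semantics.** An *argument structure* is a pair $\mathscr{D} = \langle T, f\rangle$ where $T$ is a finite rooted tree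 with order relation $\omega$, with nodes labelled by formulas and top-nodes partitioned into axiomatic and non-axiomatic ones; $f$ is a discharge function, mapping onto lower nodes elements of (a) a subset of the non-axiomatic top-nodes, (b) a subset of the axiomatic top-nodes labelled by atoms, (c) a subset of $\wp(\omega)$, each element of which contains only the pairs linking a node labelled by an atom to all its children, labelled by atoms too, with no non-axiomatic top-node mapped by $f$ onto such a maximal node or onto the image of the latter under $f$ (so $f$ indicates where assumptions, atomic axioms and atomic rules are discharged). The non-axiomatic top-nodes are the assumptions, the root is the conclusion. $\mathscr{D}$ is *closed* if the domain of $f$ contains all non-axiomatic top-nodes, otherwise *open*; it is *from* $\Gamma$ *to* (or *for* ) $A$ when $\Gamma$ is its set of undischarged assumptions and $A$ its conclusion. (Immediate) sub-structures, and the replacement $\mathscr{D}[\mathscr{D}^{**}/\mathscr{D}^{*}]$ of a sub-structure $\mathscr{D}^{*}$ by $\mathscr{D}^{**}$, are defined as usual. If $\mathscr{D}$ is from $\{A_1,\ldots,A_n\}$ to $A$ and $\sigma$ maps formulas to argument structures so that $\sigma(A_i)$ is a (closed) argument structure for $A_i$, then $\mathscr{D}^{\sigma} = \mathscr{D}[\sigma(A_1),\ldots,\sigma(A_n)/A_1,\ldots,A_n]$ is a (closed) *instance* of $\mathscr{D}$. An *inference* is a triple $\langle\langle \mathscr{D}_1,\ldots,\mathscr{D}_n\rangle, A, \delta\rangle$ ($n \ge 0$) with $\delta$ an extension of the discharge functions of the $\mathscr{D}_i$; its associated argument structure joins the trees of the $\mathscr{D}_i$ by a new root $A$, with discharges as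 given by $\delta$. An *inference rule* is a set of inferences. $\mathscr{D}$ is *canonical* iff it is associated to an instance of one of Gentzen's introduction rules for $\wedge,\vee,\rightarrow$. A *reduction* for a rule $R$ is a function $\phi$ from and to argument structures, defined on some subset $\mathbb{D}$ of $R$, such that for every $\mathscr{D}$ associated to an element of $\mathbb{D}$ and every $\sigma$: (1) the instance of $R$ to which $\mathscr{D}^{\sigma}$ is associated is in $\mathbb{D}$; (2) $\phi$ is defined on $\mathscr{D}^{\sigma}$ and $\phi(\mathscr{D}^{\sigma}) = \phi(\mathscr{D})^{\sigma}$; (3) if $\mathscr{D}$ is from $\Gamma$ to $A$, then $\phi(\mathscr{D})$ is from some $\Gamma^{*} \subseteq \Gamma$ to $A$. No constructivity or schematicity restriction is put on reductions. $\mathfrak{J}$ denotes a set of reductions; an extension of it is any set of reductions $\mathfrak{J}^{+} \supseteq \mathfrak{J}$. $\mathscr{D}$ *immediately reduces* to $\mathscr{D}^{*}$ via $\mathfrak{J}$ iff for some sub-structure $\mathscr{D}^{**}$ of $\mathscr{D}$ and some $\phi \in \mathfrak{J}$, $\mathscr{D}^{*} = \mathscr{D}[\phi(\mathscr{D}^{**})/\mathscr{D}^{**}]$; $\leq_{\mathfrak{J}}$ is the reflexive-transitive closure of this relation. An *argument* is a pair $\langle \mathscr{D}, \mathfrak{J}\rangle$, closed or open as $\mathscr{D}$ is. *Validity on* $\mathfrak{B}$ of $\langle \mathscr{D}, \mathfrak{J}\rangle$: if $\mathscr{D}$ is closed with atomic conclusion, it is valid iff $\mathscr{D} \leq_{\mathfrak{J}}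 \mathscr{D}^{*}$ for some $\mathscr{D}^{*} = \langle T,f\rangle$ with $T \in \mathrm{DER}_{\mathfrak{B}}$; if $\mathscr{D}$ is closed with non-atomic conclusion, it is valid iff $\mathscr{D} \leq_{\mathfrak{J}} \mathscr{D}^{*}$ for some canonical $\mathscr{D}^{*}$ whose immediate sub-structures are valid on $\mathfrak{B}$ when paired with $\mathfrak{J}$; if $\mathscr{D}$ is open with undischarged assumptions $A_1,\ldots,A_n$, it is valid iff for every $\sigma$ and every extension $\mathfrak{J}^{+}$ of $\mathfrak{J}$, if each $\langle \sigma(A_i), \mathfrak{J}^{+}\rangle$ ($i \le n$) is closed and valid on $\mathfrak{B}$, then $\langle \mathscr{D}^{\sigma}, \mathfrak{J}^{+}\rangle$ is valid on $\mathfrak{B}$. $\Gamma \models^{\alpha}_{\mathfrak{B}} A$ iff there is an argument $\langle \mathscr{D}, \mathfrak{J}\rangle$ from $\Gamma$ to $A$ valid on $\mathfrak{B}$. *)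

theory Defs
  imports "HOL-Library.FSet" "HOL-Library.Sublist"
begin

section \<open>Formulas\<close>

datatype atom = Var nat | Bot

datatype form = At atom | Con form form | Dis form form | Imp form form

definition is_atomic :: "form \<Rightarrow> bool" where
  "is_atomic A \<longleftrightarrow> (\<exists>a. A = At a)"


section \<open>Atomic rules and atomic bases\<close>

text \<open>
  \<open>Rule [(C1, a1), \<dots>, (Cn, an)] a\<close> infers \<open>a\<close> from \<open>a1\<close>, \<dots>, \<open>an\<close>, discharging the finite set
  of rules \<open>Ci\<close> above the \<open>i\<close>-th premise. The atom \<open>a\<close>, as a rule of level 0, is \<open>Rule [] a\<close>.
\<close>

datatype rule = Rule "(rule fset \<times> atom) list" atom

text \<open>
  A premise \<open>(C, a)\<close> is itself the rule ``from \<open>C\<close> infer \<open>a\<close>''. Given the levels of the elements of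
  \<open>C\<close>, its level is \<open>prem_level\<close>; it is just an atom, of level 0, if \<open>C\<close> is empty.
\<close>

definition prem_level :: "nat fset \<Rightarrow> nat" where
  "prem_level N = (if N = {||} then 0 else Suc (fMax N))"

primrec level :: "rule \<Rightarrow> nat" where
  "level (Rule ps a) =
     (if ps = [] then 0
      else Suc (Max ((prem_level \<circ> fst) ` set (map (map_prod (fimage level) id) ps))))"

inductive derivable :: "rule set \<Rightarrow> atom \<Rightarrow> bool" where
  "\<lbrakk>Rule ps a \<in> S; \<And>C b. (C, b) \<in> set ps \<Longrightarrow> derivable (S \<union> fset C) b\<rbrakk> \<Longrightarrow> derivable S a"

definition atomic_base :: "rule set \<Rightarrow> bool" where
  "atomic_base \<BB> \<longleftrightarrow> (\<exists>k. \<forall>R\<in>\<BB>. level R \<le> k) \<and> \<not> derivable \<BB> Bot"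


section \<open>Base semantics, non-monotonic version\<close>

text \<open>
  In the clause for disjunction the consequence of an atom \<open>c\<close> from one formula is unfolded
  according to \<open>sandqvist_consequence\<close> below.
\<close>

primrec sandqvist_valid :: "rule set \<Rightarrow> form \<Rightarrow> bool" where
  "sandqvist_valid \<BB> (At a) \<longleftrightarrow> derivable \<BB> a"
| "sandqvist_valid \<BB> (Con A B) \<longleftrightarrow> sandqvist_valid \<BB> A \<and> sandqvist_valid \<BB> B"
| "sandqvist_valid \<BB> (Dis A B) \<longleftrightarrow>
     (\<forall>c. (sandqvist_valid \<BB> A \<longrightarrow> derivable \<BB> c) \<and> (sandqvist_valid \<BB> B \<longrightarrow> derivable \<BB> c)
        \<longrightarrow> derivable \<BB> c)"
| "sandqvist_valid \<BB> (Imp A B) \<longleftrightarrow> (sandqvist_valid \<BB> A \<longrightarrow> sandqvist_valid \<BB> B)"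

definition sandqvist_consequence :: "rule set \<Rightarrow> form set \<Rightarrow> form \<Rightarrow> bool" where
  "sandqvist_consequence \<BB> \<Gamma> A \<longleftrightarrow>
     (if \<Gamma> = {} then sandqvist_valid \<BB> A
      else (\<forall>B\<in>\<Gamma>. sandqvist_valid \<BB> B) \<longrightarrow> sandqvist_valid \<BB> A)"


section \<open>Argument structures\<close>

text \<open>
  \<open>Asm A\<close> is a non-axiomatic top-node and \<open>Nd A []\<close> an axiomatic one. A node of a tree is given by
  the path that leads to it from the root \<open>[]\<close>, so that a node \<open>p\<close> is (strictly) lower than a node
  \<open>q\<close> iff \<open>p\<close> is a (strict) prefix of \<open>q\<close>.
\<close>

datatype tree = Asm form | Nd form "tree list"

type_synonym node = "nat list"

primrec label :: "tree \<Rightarrow> form" where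
  "label (Asm A) = A"
| "label (Nd A ts) = A"

fun is_node :: "tree \<Rightarrow> node \<Rightarrow> bool" where
  "is_node T [] \<longleftrightarrow> True"
| "is_node (Nd A ts) (i # p) \<longleftrightarrow> i < length ts \<and> is_node (ts ! i) p"
| "is_node (Asm A) (i # p) \<longleftrightarrow> False"

text \<open>Only meaningful for nodes of the tree.\<close>

fun subtree :: "tree \<Rightarrow> node \<Rightarrow> tree" where
  "subtree T [] = T"
| "subtree (Nd A ts) (i # p) = subtree (ts ! i) p"
| "subtree (Asm A) (i # p) = Asm A"

text \<open>
  A discharge function is a partial function from nodes to nodes. A set of edges linking an inner
  node to all of its children, i.e. an application of an atomic rule, is represented by that inner
  node.
\<close>

type_synonym discharge = "node \<rightharpoonup> node"

type_synonym arg_struct = "tree \<times> discharge"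

definition asm_at :: "tree \<Rightarrow> node \<Rightarrow> form \<Rightarrow> bool" where
  "asm_at T p A \<longleftrightarrow> is_node T p \<and> subtree T p = Asm A"

definition axiom_at :: "tree \<Rightarrow> node \<Rightarrow> form \<Rightarrow> bool" where
  "axiom_at T p A \<longleftrightarrow> is_node T p \<and> subtree T p = Nd A []"

definition step_at :: "tree \<Rightarrow> node \<Rightarrow> form list \<Rightarrow> form \<Rightarrow> bool" where
  "step_at T p As A \<longleftrightarrow>
     is_node T p \<and> As \<noteq> [] \<and> (\<exists>ts. subtree T p = Nd A ts \<and> map label ts = As)"

definition atomic_step_at :: "tree \<Rightarrow> node \<Rightarrow> bool" where
  "atomic_step_at T p \<longleftrightarrow> (\<exists>As A. step_at T p As A \<and> is_atomic A \<and> (\<forall>B\<in>set As. is_atomic B))"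

definition argument_structure :: "arg_struct \<Rightarrow> bool" where
  "argument_structure D \<longleftrightarrow> (case D of (T, f) \<Rightarrow>
     (\<forall>p q. f p = Some q \<longrightarrow>
        strict_prefix q p \<and>
        ((\<exists>A. asm_at T p A) \<or> (\<exists>a. axiom_at T p (At a)) \<or> atomic_step_at T p)) \<and>
     (\<forall>p q. f p = Some q \<longrightarrow> atomic_step_at T p \<longrightarrow>
        (\<forall>r A. asm_at T r A \<longrightarrow> f r \<noteq> Some p \<and> f r \<noteq> Some q)))"

definition conclusion :: "arg_struct \<Rightarrow> form" where
  "conclusion D = label (fst D)"

definition open_at :: "arg_struct \<Rightarrow> node \<Rightarrow> form \<Rightarrow> bool" where
  "open_at D p A \<longleftrightarrow> asm_at (fst D) p A \<and> snd D p = None"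

definition assumptions :: "arg_struct \<Rightarrow> form set" where
  "assumptions D = {A. \<exists>p. open_at D p A}"

definition closed_structure :: "arg_struct \<Rightarrow> bool" where
  "closed_structure D \<longleftrightarrow> (\<forall>p A. asm_at (fst D) p A \<longrightarrow> p \<in> dom (snd D))"

text \<open>
  In the sub-structure at a node, whatever is discharged below that node becomes undischarged.
\<close>

definition substructure :: "arg_struct \<Rightarrow> node \<Rightarrow> arg_struct" where
  "substructure D p = (subtree (fst D) p,
     \<lambda>q. case snd D (p @ q) of
           None \<Rightarrow> None
         | Some r \<Rightarrow> if prefix p r then Some (drop (length p) r) else None)"

definition immediate_substructures :: "arg_struct \<Rightarrow> arg_struct set" where
  "immediate_substructures D = {substructure D [i] | i. is_node (fst D) [i]}"


section \<open>Replacement and instances\<close>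

text \<open>Replace the subtree at every (lowest) node in the domain of \<open>g\<close>.\<close>

function graft :: "tree \<Rightarrow> (node \<rightharpoonup> tree) \<Rightarrow> tree" where
  "graft (Asm A) g = (case g [] of Some U \<Rightarrow> U | None \<Rightarrow> Asm A)"
| "graft (Nd A ts) g = (case g [] of Some U \<Rightarrow> U
     | None \<Rightarrow> Nd A (map (\<lambda>i. graft (ts ! i) (\<lambda>p. g (i # p))) [0..<length ts]))"
  by pat_completeness auto
termination
  by (relation "measure (size \<circ> fst)") (auto simp: less_Suc_eq_le intro!: size_list_estimation')

text \<open>
  The same for structures: the discharges inside the inserted structures are those that these
  structures come with, the discharges outside are those of \<open>D\<close>.
\<close>

definition plug :: "arg_struct \<Rightarrow> (node \<rightharpoonup> arg_struct) \<Rightarrow> arg_struct" where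
  "plug D g = (graft (fst D) (map_option fst \<circ> g),
     \<lambda>r. case find (\<lambda>p. p \<in> dom g) (prefixes r) of
           None \<Rightarrow> snd D r
         | Some p \<Rightarrow> map_option ((@) p) (snd (the (g p)) (drop (length p) r)))"

definition substitution_for :: "arg_struct \<Rightarrow> (form \<Rightarrow> arg_struct) \<Rightarrow> bool" where
  "substitution_for D \<sigma> \<longleftrightarrow>
     (\<forall>A\<in>assumptions D. argument_structure (\<sigma> A) \<and> conclusion (\<sigma> A) = A)"

definition inst :: "(form \<Rightarrow> arg_struct) \<Rightarrow> arg_struct \<Rightarrow> arg_struct" where
  "inst \<sigma> D =
     plug D (\<lambda>p. if \<exists>A. open_at D p A then Some (\<sigma> (label (subtree (fst D) p))) else None)"

text \<open>
  Let \<open>E\<close> replace the sub-structure of \<open>D\<close> at \<open>p\<close>. An assumption (an atomic axiom, an atomic rule)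
  of that sub-structure may be discharged by \<open>D\<close> below \<open>p\<close>, and such discharges have to carry over
  to \<open>E\<close>. Whatever is undischarged in \<open>E\<close> inherits its discharge, or lack of discharge, from some
  like occurrence that is undischarged in the replaced sub-structure; if there are several such
  occurrences any of them may be chosen, and if there is none it remains undischarged. So
  replacement is a relation.
\<close>

definition rule_at :: "arg_struct \<Rightarrow> node \<Rightarrow> form list \<Rightarrow> form \<Rightarrow> bool" where
  "rule_at D p As A \<longleftrightarrow> atomic_step_at (fst D) p \<and> step_at (fst D) p As A \<and>
     (\<forall>r B. asm_at (fst D) r B \<longrightarrow> snd D r \<noteq> Some p)"

definition like_occurrences :: "arg_struct \<Rightarrow> node \<Rightarrow> arg_struct \<Rightarrow> node \<Rightarrow> bool" where
  "like_occurrences D p E q \<longleftrightarrow>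
     (\<exists>A. asm_at (fst D) p A \<and> asm_at (fst E) q A) \<or>
     (\<exists>a. axiom_at (fst D) p (At a) \<and> axiom_at (fst E) q (At a)) \<or>
     (\<exists>As A. rule_at D p As A \<and> rule_at E q As A)"

definition inherited :: "arg_struct \<Rightarrow> node \<Rightarrow> arg_struct \<Rightarrow> node \<Rightarrow> node option set" where
  "inherited D p E q = (let
      W = {w. snd (substructure D p) w = None \<and> like_occurrences (substructure D p) w E q}
    in if W = {} then {None} else (\<lambda>w. snd D (p @ w)) ` W)"

definition replacement :: "arg_struct \<Rightarrow> node \<Rightarrow> arg_struct \<Rightarrow> arg_struct \<Rightarrow> bool" where
  "replacement D p E D' \<longleftrightarrow>
     fst D' = fst (plug D [p \<mapsto> E]) \<and>
     (\<forall>r. \<not> prefix p r \<longrightarrow> snd D' r = snd (plug D [p \<mapsto> E]) r) \<and>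
     (\<forall>q. if snd E q = None then snd D' (p @ q) \<in> inherited D p E q
           else snd D' (p @ q) = snd (plug D [p \<mapsto> E]) (p @ q))"


section \<open>Inferences, canonical structures, reductions\<close>

type_synonym inference = "arg_struct list \<times> form \<times> discharge"

definition associated :: "inference \<Rightarrow> arg_struct" where
  "associated \<iota> = (case \<iota> of (Ds, A, \<delta>) \<Rightarrow> (Nd A (map fst Ds), \<delta>))"

definition prior_discharge :: "arg_struct list \<Rightarrow> discharge" where
  "prior_discharge Ds p = (case p of
       [] \<Rightarrow> None
     | i # q \<Rightarrow> if i < length Ds then map_option ((#) i) (snd (Ds ! i) q) else None)"

definition inference :: "inference \<Rightarrow> bool" where
  "inference \<iota> \<longleftrightarrow> (case \<iota> of (Ds, A, \<delta>) \<Rightarrow>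
     (\<forall>D\<in>set Ds. argument_structure D) \<and> prior_discharge Ds \<subseteq>\<^sub>m \<delta> \<and>
     argument_structure (associated \<iota>))"

definition con_intro :: "inference set" where
  "con_intro = {\<iota>. inference \<iota> \<and> (\<exists>D1 D2.
     \<iota> = ([D1, D2], Con (conclusion D1) (conclusion D2), prior_discharge [D1, D2]))}"

definition dis_intro :: "inference set" where
  "dis_intro = {\<iota>. inference \<iota> \<and> (\<exists>D A B. (conclusion D = A \<or> conclusion D = B) \<and>
     \<iota> = ([D], Dis A B, prior_discharge [D]))}"

text \<open>Any number of occurrences of \<open>A\<close>, possibly none, is discharged.\<close>

definition imp_intro :: "inference set" where
  "imp_intro = {\<iota>. inference \<iota> \<and> (\<exists>D A \<delta>. \<iota> = ([D], Imp A (conclusion D), \<delta>) \<and>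
     (\<forall>p q. \<delta> p = Some q \<longrightarrow> prior_discharge [D] p = None \<longrightarrow>
        q = [] \<and> asm_at (fst (associated \<iota>)) p A))}"

definition canonical :: "arg_struct \<Rightarrow> bool" where
  "canonical D \<longleftrightarrow> D \<in> associated ` (con_intro \<union> dis_intro \<union> imp_intro)"

definition reduction_for :: "inference set \<Rightarrow> (arg_struct \<rightharpoonup> arg_struct) \<Rightarrow> bool" where
  "reduction_for R \<phi> \<longleftrightarrow> (\<exists>\<DD>\<subseteq>R. dom \<phi> = associated ` \<DD> \<and>
     (\<forall>\<iota>\<in>\<DD>. \<exists>E. \<phi> (associated \<iota>) = Some E \<and> argument_structure E \<and>
        assumptions E \<subseteq> assumptions (associated \<iota>) \<and>
        conclusion E = conclusion (associated \<iota>) \<and>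
        (\<forall>\<sigma>. substitution_for (associated \<iota>) \<sigma> \<longrightarrow>
           inst \<sigma> (associated \<iota>) \<in> associated ` \<DD> \<and>
           \<phi> (inst \<sigma> (associated \<iota>)) = Some (inst \<sigma> E))))"

definition reduction :: "(arg_struct \<rightharpoonup> arg_struct) \<Rightarrow> bool" where
  "reduction \<phi> \<longleftrightarrow> (\<exists>R. (\<forall>\<iota>\<in>R. inference \<iota>) \<and> reduction_for R \<phi>)"

definition immediately_reduces ::
  "(arg_struct \<rightharpoonup> arg_struct) set \<Rightarrow> arg_struct \<Rightarrow> arg_struct \<Rightarrow> bool" where
  "immediately_reduces J D D' \<longleftrightarrow> (\<exists>p. \<exists>\<phi>\<in>J. \<exists>E. is_node (fst D) p \<and>
     \<phi> (substructure D p) = Some E \<and> replacement D p E D')"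

abbreviation reduces :: "(arg_struct \<rightharpoonup> arg_struct) set \<Rightarrow> arg_struct \<Rightarrow> arg_struct \<Rightarrow> bool" where
  "reduces J \<equiv> (immediately_reduces J)\<^sup>*\<^sup>*"

definition is_argument :: "arg_struct \<Rightarrow> (arg_struct \<rightharpoonup> arg_struct) set \<Rightarrow> bool" where
  "is_argument D J \<longleftrightarrow> argument_structure D \<and> (\<forall>\<phi>\<in>J. reduction \<phi>)"


section \<open>Atomic derivations as argument structures\<close>

text \<open>
  \<open>derivation S f p T\<close>: the tree \<open>T\<close>, placed at node \<open>p\<close>, with discharges given by \<open>f\<close>, is a
  derivation from the rules in \<open>S\<close>. Every available rule is paired with its origin: \<open>None\<close> for a
  rule of the base, and \<open>Some q\<close> for a rule discharged at the node \<open>q\<close>; the discharge function has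
  to agree with the origin of the rule applied at each node.
\<close>

inductive derivation ::
  "(rule \<times> node option) set \<Rightarrow> discharge \<Rightarrow> node \<Rightarrow> tree \<Rightarrow> bool" where
  "\<lbrakk>(Rule ps a, f p) \<in> S; map label ts = map (At \<circ> snd) ps;
    \<And>i. i < length ps \<Longrightarrow>
       derivation (S \<union> fset (fst (ps ! i)) \<times> {Some p}) f (p @ [i]) (ts ! i)\<rbrakk>
   \<Longrightarrow> derivation S f p (Nd (At a) ts)"

definition DER :: "rule set \<Rightarrow> arg_struct set" where
  "DER \<BB> = {(T, f). argument_structure (T, f) \<and> derivation (\<BB> \<times> {None}) f [] T}"


section \<open>Conclusions and assumptions under replacement and instances\<close>

lemma is_node_append: "is_node T (p @ q) \<longleftrightarrow> is_node T p \<and> is_node (subtree T p) q"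
  by (induction T p rule: is_node.induct) auto

lemma subtree_append: "subtree T (p @ q) = subtree (subtree T p) q"
proof (induction T p rule: subtree.induct)
  case (3 A i p)
  show ?case by (cases q) auto
qed auto

lemma closed_structure_iff: "closed_structure D \<longleftrightarrow> assumptions D = {}"
  by (auto simp: closed_structure_def assumptions_def open_at_def)

lemma finite_asm: "finite {A. \<exists>p. asm_at T p A}"
proof (induction T)
  case (Asm B)
  have "{A. \<exists>p. asm_at (Asm B) p A} \<subseteq> {B}"
    by (auto simp: asm_at_def elim: is_node.elims)
  then show ?case using finite_subset by blast
next
  case (Nd B ts)
  have "{A. \<exists>p. asm_at (Nd B ts) p A} \<subseteq> (\<Union>t\<in>set ts. {A. \<exists>p. asm_at t p A})"
  proof (intro subsetI)
    fix A assume "A \<in> {A. \<exists>p. asm_at (Nd B ts) p A}"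
    then obtain p where "asm_at (Nd B ts) p A" by blast
    then show "A \<in> (\<Union>t\<in>set ts. {A. \<exists>p. asm_at t p A})"
      by (cases p) (auto simp: asm_at_def intro: nth_mem)
  qed
  moreover have "finite (\<Union>t\<in>set ts. {A. \<exists>p. asm_at t p A})" using Nd by auto
  ultimately show ?case using finite_subset by blast
qed

lemma finite_assumptions: "finite (assumptions D)"
  by (rule finite_subset[OF _ finite_asm[of "fst D"]]) (auto simp: assumptions_def open_at_def)

lemma graft_out: "(\<forall>p. prefix p r \<longrightarrow> g p = None) \<Longrightarrow> 
   is_node (graft T g) r = is_node T r \<and> (is_node T r \<longrightarrow> subtree (graft T g) r = graft (subtree T r) (\<lambda>q. g (r@q)))"
proof (induction r arbitrary: T g)
  case (Cons i r)
  have "g [] = None" using Cons.prems by auto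
  moreover have "\<forall>p. prefix p r \<longrightarrow> g (i#p) = None" using Cons.prems by auto
  ultimately show ?case using Cons.IH[of "\<lambda>p. g (i#p)"] by (cases T) auto
qed auto

lemma graft_in: "is_node T p \<Longrightarrow> g p = Some U \<Longrightarrow> (\<forall>p'. strict_prefix p' p \<longrightarrow> g p' = None) \<Longrightarrow> 
   is_node (graft T g) (p@q) = is_node U q \<and> subtree (graft T g) (p@q) = subtree U q"
proof (induction p arbitrary: T g)
  case Nil then show ?case by (cases T) auto
next
  case (Cons i p)
  obtain A ts where T: "T = Nd A ts" "i < length ts" "is_node (ts!i) p" using Cons.prems(1) by (cases T) auto
  have "g [] = None" using Cons.prems by auto
  moreover have "\<forall>p'. strict_prefix p' p \<longrightarrow> g (i#p') = None" using Cons.prems by auto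
  ultimately show ?case using Cons.IH[of "ts!i" "\<lambda>p. g (i#p)"] T Cons.prems(2) by auto
qed

lemma find_prefixes_None:
  "find P (prefixes r) = None \<longleftrightarrow> (\<forall>p. prefix p r \<longrightarrow> \<not> P p)"
  by (auto simp: find_None_iff)

lemma find_prefixes_Some:
  "find P (prefixes r) = Some p \<Longrightarrow> prefix p r \<and> P p \<and> (\<forall>p'. strict_prefix p' p \<longrightarrow> \<not> P p')"
proof (induction r arbitrary: P p)
  case Nil
  then show ?case by (auto split: if_splits)
next
  case (Cons i r)
  have *: "find P (map ((#) i) xs) = map_option ((#) i) (find (\<lambda>p. P (i # p)) xs)" for xs
    by (induction xs) auto
  show ?case
  proof (cases "P []")
    case True
    then show ?thesis using Cons.prems by auto
  next
    case False
    then obtain q where q: "p = i # q" "find (\<lambda>p. P (i # p)) (prefixes r) = Some q"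
      using Cons.prems * by auto
    show ?thesis using Cons.IH[OF q(2)] False
      by (simp add: q(1)) (metis Cons_prefix_Cons list.exhaust strict_prefix_def)
  qed
qed

lemma find_prefixes_single:
  "find (\<lambda>p'. p' \<in> dom [p \<mapsto> E]) (prefixes r) = (if prefix p r then Some p else None)"
proof -
  have "find (\<lambda>p'. p' = p) xs = (if p \<in> set xs then Some p else None)" for xs
    by (induction xs) auto
  then show ?thesis by auto
qed

lemma conclusion_replacement:
  assumes "replacement D p E D'" "is_node (fst D) p" "conclusion E = conclusion (substructure D p)"
  shows "conclusion D' = conclusion D"
  using assms
  by (cases "fst D"; cases p)
     (auto simp: replacement_def plug_def conclusion_def substructure_def)

lemma assumptions_replacement:
  assumes rep: "replacement D p E D'" and p: "is_node (fst D) p"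
    and sub: "assumptions E \<subseteq> assumptions (substructure D p)"
  shows "assumptions D' \<subseteq> assumptions D"
proof
  fix A assume "A \<in> assumptions D'"
  then obtain r where r: "asm_at (fst D') r A" "snd D' r = None"
    by (auto simp: assumptions_def open_at_def)
  let ?g = "[p \<mapsto> E]" let ?h = "map_option fst \<circ> ?g"
  have T: "fst D' = graft (fst D) ?h" using rep by (simp add: replacement_def plug_def)
  have h: "?h = [p \<mapsto> fst E]" by (auto simp: fun_eq_iff)
  have n: "is_node (graft (fst D) ?h) r" and A: "subtree (graft (fst D) ?h) r = Asm A"
    using r T by (auto simp: asm_at_def)
  show "A \<in> assumptions D"
  proof (cases "prefix p r")
    case True
    then obtain q where q: "r = p @ q" by (auto simp: prefix_def)
    have "\<forall>p'. strict_prefix p' p \<longrightarrow> ?h p' = None" "?h p = Some (fst E)" by (auto simp: h)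
    then have qE: "asm_at (fst E) q A"
      using graft_in[of "fst D" p ?h "fst E" q] p n A q by (auto simp: asm_at_def)
    have pl: "snd (plug D ?g) (p @ q) = map_option ((@) p) (snd E q)"
      using find_prefixes_single[of p E "p @ q"] by (simp add: plug_def)
    have E_q: "snd E q = None"
    proof (rule ccontr)
      assume "snd E q \<noteq> None"
      moreover from this have "snd D' (p @ q) = snd (plug D ?g) (p @ q)"
        using rep by (auto simp: replacement_def)
      ultimately show False using r q pl by auto
    qed
    then have "snd D' (p @ q) \<in> inherited D p E q"
      using rep by (auto simp: replacement_def)
    then have inh: "None \<in> inherited D p E q" using r q by simp
    have "A \<in> assumptions (substructure D p)"
      using sub qE E_q by (auto simp: assumptions_def open_at_def)
    then obtain w where w: "asm_at (fst (substructure D p)) w A" "snd (substructure D p) w = None"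
      by (auto simp: assumptions_def open_at_def)
    define W where "W = {w. snd (substructure D p) w = None \<and> like_occurrences (substructure D p) w E q}"
    have "w \<in> W" using w qE by (auto simp: W_def like_occurrences_def)
    then have "None \<in> (\<lambda>w. snd D (p @ w)) ` W"
      using inh by (auto simp: inherited_def Let_def W_def[symmetric] split: if_splits)
    then obtain v where v: "v \<in> W" "snd D (p @ v) = None" by auto
    then have "asm_at (subtree (fst D) p) v A"
      using qE by (auto simp: W_def like_occurrences_def asm_at_def axiom_at_def rule_at_def
          step_at_def substructure_def)
    then have "open_at D (p @ v) A"
      using p v by (auto simp: open_at_def asm_at_def is_node_append subtree_append)
    then show ?thesis by (auto simp: assumptions_def)
  next
    case False
    then have "\<forall>p'. prefix p' r \<longrightarrow> ?h p' = None" by (auto simp: h)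
    then have "is_node (fst D) r" and g: "graft (subtree (fst D) r) (\<lambda>q. ?h (r @ q)) = Asm A"
      using graft_out[of r ?h "fst D"] n A by auto
    moreover have "?h (r @ []) = None" using False by (auto simp: h)
    then have "subtree (fst D) r = Asm A" using g
      by (cases "subtree (fst D) r") auto
    moreover have "snd D r = None"
    proof -
      have "snd D' r = snd (plug D ?g) r" using rep False by (simp add: replacement_def)
      also have "\<dots> = snd D r" using False find_prefixes_single[of p E r] by (simp add: plug_def)
      finally show ?thesis using r by simp
    qed
    ultimately show ?thesis by (auto simp: assumptions_def open_at_def asm_at_def)
  qed
qed

lemma reductionD:
  assumes "reduction \<phi>" "\<phi> D = Some E"
  shows "argument_structure E" "assumptions E \<subseteq> assumptions D" "conclusion E = conclusion D"
proof -
  obtain \<DD> where \<DD>: "dom \<phi> = associated ` \<DD>"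
    "\<forall>\<iota>\<in>\<DD>. \<exists>E. \<phi> (associated \<iota>) = Some E \<and> argument_structure E \<and>
        assumptions E \<subseteq> assumptions (associated \<iota>) \<and> conclusion E = conclusion (associated \<iota>)"
    using assms(1) unfolding reduction_def reduction_for_def by metis
  moreover have "D \<in> associated ` \<DD>" using assms(2) \<DD>(1) by blast
  ultimately show "argument_structure E" "assumptions E \<subseteq> assumptions D" "conclusion E = conclusion D"
    using assms(2) by fastforce+
qed

lemma reduces_conclusion_assumptions:
  assumes "reduces J D D'" "\<forall>\<phi>\<in>J. reduction \<phi>"
  shows "conclusion D' = conclusion D \<and> assumptions D' \<subseteq> assumptions D"
  using assms(1)
proof induction
  case (step D1 D2)
  then obtain p \<phi> E where "is_node (fst D1) p" "\<phi> \<in> J" "\<phi> (substructure D1 p) = Some E"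
    "replacement D1 p E D2"
    by (auto simp: immediately_reduces_def)
  then have "conclusion D2 = conclusion D1" "assumptions D2 \<subseteq> assumptions D1"
    using assms(2) reductionD conclusion_replacement assumptions_replacement by metis+
  then show ?case using step by auto
qed auto

lemma conclusion_inst:
  assumes "substitution_for D \<sigma>"
  shows "conclusion (inst \<sigma> D) = conclusion D"
proof (cases "\<exists>A. open_at D [] A")
  case True
  then obtain A where A: "open_at D [] A" ..
  then have "conclusion (\<sigma> A) = A" using assms by (auto simp: substitution_for_def assumptions_def)
  then show ?thesis using A
    by (cases "fst D") (auto simp: inst_def plug_def conclusion_def open_at_def asm_at_def)
next
  case False
  then show ?thesis
    by (cases "fst D") (auto simp: inst_def plug_def conclusion_def)
qed

lemma closed_inst:
  assumes "\<forall>A\<in>assumptions D. closed_structure (\<sigma> A)"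
  shows "closed_structure (inst \<sigma> D)"
  unfolding closed_structure_def
proof (intro allI impI)
  fix r A
  define g where
    "g = (\<lambda>p. if \<exists>A. open_at D p A then Some (\<sigma> (label (subtree (fst D) p))) else None)"
  let ?h = "map_option fst \<circ> g"
  have D': "inst \<sigma> D = plug D g" by (simp add: inst_def g_def)
  assume r: "asm_at (fst (inst \<sigma> D)) r A"
  then have n: "is_node (graft (fst D) ?h) r" and A: "subtree (graft (fst D) ?h) r = Asm A"
    by (auto simp: asm_at_def D' plug_def)
  show "r \<in> dom (snd (inst \<sigma> D))"
  proof (cases "find (\<lambda>p. p \<in> dom g) (prefixes r)")
    case None
    then have g: "\<forall>p. prefix p r \<longrightarrow> g p = None" by (auto simp: find_prefixes_None)
    then have "\<forall>p. prefix p r \<longrightarrow> ?h p = None" by simp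
    then have r': "is_node (fst D) r" and gr: "graft (subtree (fst D) r) (\<lambda>q. ?h (r @ q)) = Asm A"
      using graft_out[of r ?h "fst D"] n A by auto
    have gr0: "g r = None" using g by simp
    then have "asm_at (fst D) r A" using r' gr by (cases "subtree (fst D) r") (auto simp: asm_at_def)
    then have "snd D r \<noteq> None" using gr0 by (auto simp: g_def open_at_def split: if_splits)
    then show ?thesis using None by (auto simp: D' plug_def)
  next
    case (Some p)
    note p = find_prefixes_Some[OF Some]
    then obtain B where B: "open_at D p B" by (auto simp: g_def split: if_splits)
    then have gp: "g p = Some (\<sigma> B)" by (auto simp: g_def open_at_def asm_at_def)
    obtain q where q: "r = p @ q" using p by (auto simp: prefix_def)
    have "\<forall>p'. strict_prefix p' p \<longrightarrow> ?h p' = None" using p unfolding domIff by fastforce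
    moreover have "is_node (fst D) p" "?h p = Some (fst (\<sigma> B))"
      using B gp by (simp_all add: open_at_def asm_at_def)
    ultimately have "asm_at (fst (\<sigma> B)) q A"
      using graft_in[of "fst D" p ?h "fst (\<sigma> B)" q] n A q by (simp add: asm_at_def)
    moreover have "closed_structure (\<sigma> B)" using B assms by (auto simp: assumptions_def)
    ultimately show ?thesis using Some gp q by (auto simp: D' plug_def closed_structure_def)
  qed
qed

section \<open>Validity and consequence in reducibility semantics\<close>

definition rank :: "arg_struct \<Rightarrow> nat" where
  "rank D = Max (size ` insert (conclusion D) (assumptions D))"

lemma rank_less_iff:
  "rank D < n \<longleftrightarrow> size (conclusion D) < n \<and> (\<forall>A\<in>assumptions D. size A < n)"
  unfolding rank_def using finite_assumptions[of D] by (subst Max_less_iff) auto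

lemma size_le_rank:
  "size (conclusion D) \<le> rank D" "A \<in> assumptions D \<Longrightarrow> size A \<le> rank D"
  unfolding rank_def using finite_assumptions[of D] by (auto intro!: Max_ge)

lemma rank_closed: "closed_structure D \<Longrightarrow> rank D = size (conclusion D)"
  by (simp add: rank_def closed_structure_iff)

lemma assumptions_substructure_associated:
  assumes "inference (Ds, A, \<delta>)" "i < length Ds" "B \<in> assumptions (substructure (associated (Ds, A, \<delta>)) [i])"
  obtains p where "asm_at (fst (associated (Ds, A, \<delta>))) (i # p) B"
    "\<delta> (i # p) = None \<or> \<delta> (i # p) = Some [] \<and> prior_discharge Ds (i # p) = None"
proof -
  obtain p where p: "is_node (fst (Ds ! i)) p" "subtree (fst (Ds ! i)) p = Asm B"
    "snd (substructure (associated (Ds, A, \<delta>)) [i]) p = None"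
    using assms(2,3)
    by (auto simp: assumptions_def open_at_def asm_at_def substructure_def associated_def)
  have args: "argument_structure (Nd A (map fst Ds), \<delta>)" and le: "prior_discharge Ds \<subseteq>\<^sub>m \<delta>"
    using assms(1) unfolding inference_def associated_def prod.case by blast+
  have "\<delta> (i # p) = None \<or> \<delta> (i # p) = Some [] \<and> prior_discharge Ds (i # p) = None"
  proof (cases "\<delta> (i # p)")
    case (Some r)
    then have "strict_prefix r (i # p)"
      using args unfolding argument_structure_def prod.case by blast
    moreover have "\<not> prefix [i] r"
      using p(3) Some by (auto simp: substructure_def associated_def split: if_splits)
    ultimately have "r = []" by (cases r) (auto simp: strict_prefix_def)
    moreover have "prior_discharge Ds (i # p) \<noteq> Some []" by (auto simp: prior_discharge_def)
    ultimately show ?thesis using le Some unfolding map_le_def by (metis domIff)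
  qed simp
  then show thesis using that p assms(2) by (auto simp: associated_def asm_at_def)
qed

lemma rank_immediate_substructure:
  assumes "canonical D" "closed_structure D" "D' \<in> immediate_substructures D"
  shows "rank D' < size (conclusion D)"
proof -
  obtain Ds A \<delta> where \<iota>: "inference (Ds, A, \<delta>)" "D = associated (Ds, A, \<delta>)"
    "(Ds, A, \<delta>) \<in> con_intro \<union> dis_intro \<union> imp_intro"
    using assms(1) by (auto simp: canonical_def con_intro_def dis_intro_def imp_intro_def)
  obtain i where i: "i < length Ds" "D' = substructure D [i]"
    using assms(3) \<iota>(2) by (auto simp: immediate_substructures_def associated_def)
  have concl: "conclusion D' = conclusion (Ds ! i)" "conclusion D = A"
    using i \<iota>(2) by (auto simp: conclusion_def substructure_def associated_def)
  have asm: "\<exists>p. asm_at (fst D) (i # p) B \<and> \<delta> (i # p) = Some [] \<and> prior_discharge Ds (i # p) = None"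
    if B: "B \<in> assumptions D'" for B
  proof -
    obtain p where p: "asm_at (fst D) (i # p) B"
      "\<delta> (i # p) = None \<or> \<delta> (i # p) = Some [] \<and> prior_discharge Ds (i # p) = None"
      using assumptions_substructure_associated[OF \<iota>(1) i(1)] B i(2) \<iota>(2) by blast
    moreover have "\<delta> (i # p) \<noteq> None"
      using p(1) assms(2) \<iota>(2) by (auto simp: closed_structure_def associated_def)
    ultimately show ?thesis by blast
  qed
  consider "(Ds, A, \<delta>) \<in> con_intro" | "(Ds, A, \<delta>) \<in> dis_intro" | "(Ds, A, \<delta>) \<in> imp_intro"
    using \<iota>(3) by blast
  then show ?thesis
  proof cases
    case 1
    then obtain D1 D2 where *: "Ds = [D1, D2]" "A = Con (conclusion D1) (conclusion D2)"
      "\<delta> = prior_discharge Ds" by (auto simp: con_intro_def)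
    then have "assumptions D' = {}" using asm by force
    moreover have "i = 0 \<or> i = 1" using i(1) * by auto
    ultimately show ?thesis using * concl by (auto simp: rank_less_iff)
  next
    case 2
    then obtain D1 B C where *: "Ds = [D1]" "A = Dis B C" "conclusion D1 = B \<or> conclusion D1 = C"
      "\<delta> = prior_discharge Ds" by (auto simp: dis_intro_def)
    then have "assumptions D' = {}" using asm by force
    then show ?thesis using * concl i(1) by (auto simp: rank_less_iff)
  next
    case 3
    then obtain D1 B where *: "Ds = [D1]" "A = Imp B (conclusion D1)"
      "\<And>p q. \<delta> p = Some q \<Longrightarrow> prior_discharge [D1] p = None \<Longrightarrow> asm_at (fst D) p B"
      using \<iota>(2) by (auto simp: imp_intro_def)
    have "C = B" if "C \<in> assumptions D'" for C
      using asm[OF that] *(1) *(3) by (fastforce simp: asm_at_def)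
    then show ?thesis using * concl i(1) by (auto simp: rank_less_iff)
  qed
qed

declare conj_cong [fundef_cong]

function valid :: "rule set \<Rightarrow> arg_struct \<Rightarrow> (arg_struct \<rightharpoonup> arg_struct) set \<Rightarrow> bool" where
  "valid \<BB> D J \<longleftrightarrow> is_argument D J \<and>
     (if closed_structure D then
        if is_atomic (conclusion D) then \<exists>D'. reduces J D D' \<and> D' \<in> DER \<BB>
        else \<exists>D'. reduces J D D' \<and> canonical D' \<and> (\<forall>E\<in>immediate_substructures D'. valid \<BB> E J)
      else
        \<forall>\<sigma> J'. J \<subseteq> J' \<and> (\<forall>\<phi>\<in>J'. reduction \<phi>) \<and> substitution_for D \<sigma> \<and>
          (\<forall>A\<in>assumptions D. closed_structure (\<sigma> A) \<and> valid \<BB> (\<sigma> A) J')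
          \<longrightarrow> valid \<BB> (inst \<sigma> D) J')"
  by pat_completeness auto
termination
proof (relation "measure (\<lambda>(\<BB>, D, J). 2 * rank D + (if closed_structure D then 0 else 1))", goal_cases)
  case 1
  then show ?case by simp
next
  case (2 \<BB> D J D' E)
  then have D': "conclusion D' = conclusion D" "closed_structure D'"
    using reduces_conclusion_assumptions[of J D D'] by (auto simp: is_argument_def closed_structure_iff)
  then have "rank E < rank D"
    using rank_immediate_substructure[of D' E] rank_closed[of D] 2 by simp
  then show ?case using 2 by simp
next
  case (3 \<BB> D J \<sigma> J' A)
  then have "rank (\<sigma> A) \<le> rank D"
    using rank_closed[of "\<sigma> A"] size_le_rank(2)[of A D] by (auto simp: substitution_for_def)
  then show ?case using 3 by simp
next
  case (4 \<BB> D J \<sigma> J')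
  then have "rank (inst \<sigma> D) \<le> rank D" "closed_structure (inst \<sigma> D)"
    using rank_closed[of "inst \<sigma> D"] size_le_rank(1)[of D] closed_inst[of D \<sigma>] conclusion_inst[of D \<sigma>]
    by auto
  then show ?case using 4 by simp
qed

declare valid.simps [simp del]

definition reducibility_consequence :: "rule set \<Rightarrow> form set \<Rightarrow> form \<Rightarrow> bool" where
  "reducibility_consequence \<BB> \<Gamma> A \<longleftrightarrow>
     (\<exists>D J. is_argument D J \<and> assumptions D = \<Gamma> \<and> conclusion D = A \<and> valid \<BB> D J)"

end

theory Submission
  imports Defs
begin

text \<open>
  Write \<open>\<turnstile>\<^sup>s\<close> for consequence over the given base in base semantics and \<open>\<turnstile>\<^sup>\<alpha>\<close> for consequence over
  it in reducibility semantics. Two facts about \<open>\<turnstile>\<^sup>\<alpha>\<close> carry the proof.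

  First, \<open>\<turnstile>\<^sup>\<alpha>\<close> admits cut against closed valid arguments (\<open>reducibility_consequence_cut\<close>). Closed
  arguments for the members of \<open>\<Gamma>\<close> may each come with their own set of reductions; since validity
  survives the addition of reductions (\<open>valid_mono\<close>), all of them are valid under the union of these
  sets, and then the clause for open arguments applies to that union.

  Secondly, \<open>\<turnstile>\<^sup>\<alpha>\<close> from no assumptions can be inverted: a closed valid argument reduces to a derivation
  over the base or to a canonical structure, whose immediate sub-structures are valid arguments for
  the components of the conclusion, open at most in the antecedent of an implication.

  These give \<open>\<turnstile>\<^sup>\<alpha> A \<Longrightarrow> \<turnstile>\<^sup>s A\<close> by induction on \<open>A\<close>. The step for implication is the only place where
  inversion does not reduce the claim to the induction hypothesis: from \<open>\<turnstile>\<^sup>\<alpha> A \<rightarrow> B\<close> one obtains an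
  argument for \<open>B\<close> from at most \<open>A\<close>, and to use \<open>\<turnstile>\<^sup>s A\<close> one has to turn this truth into a closed
  valid argument for \<open>A\<close>. This is what the assumed inclusion of \<open>\<turnstile>\<^sup>s\<close> in \<open>\<turnstile>\<^sup>\<alpha>\<close> is for; cut then
  yields \<open>\<turnstile>\<^sup>\<alpha> B\<close>. Assumptions \<open>\<Gamma>\<close> are dealt with in the same way.
\<close>

section \<open>Atomic derivations\<close>

text \<open>
  The origins of the rules only regulate which discharges the tree has to record. Forgetting them
  leaves a derivation in the plain sense.
\<close>

lemma derivation_imp_derivable:
  assumes "derivation S f p T"
  shows "\<exists>a. label T = At a \<and> derivable (fst ` S) a"
  using assms
proof induction
  case (1 ps a f p S ts)
  have len: "length ts = length ps"
    using map_eq_imp_length_eq[OF "1"(2)] .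
  have "derivable (fst ` S \<union> fset C) b" if Cb: "(C, b) \<in> set ps" for C b
  proof -
    obtain i where i: "i < length ps" "ps ! i = (C, b)"
      using Cb by (auto simp: in_set_conv_nth)
    have "label (ts ! i) = At b"
      using i len arg_cong[OF "1"(2), of "\<lambda>xs. xs ! i"] by simp
    moreover have "fst ` (S \<union> fset C \<times> {Some p}) = fst ` S \<union> fset C"
      by (simp add: image_Un)
    ultimately show ?thesis using "1.IH"[OF i(1)] i(2) by auto
  qed
  moreover have "Rule ps a \<in> fst ` S" using "1"(1) by force
  ultimately show ?case by (auto intro: derivable.intros)
qed

section \<open>Monotonicity in the reductions and cut\<close>

lemma reduces_mono: "J \<subseteq> J' \<Longrightarrow> reduces J D D' \<Longrightarrow> reduces J' D D'"
  by (erule rtranclp_mono[THEN predicate2D, rotated]) (unfold immediately_reduces_def, blast)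

text \<open>
  Reduction sequences persist, and the clause for open structures already quantifies over all
  extensions.
\<close>

lemma valid_mono:
  assumes "valid \<BB> D J" "J \<subseteq> J'" "\<forall>\<phi>\<in>J'. reduction \<phi>"
  shows "valid \<BB> D J'"
  using assms
proof (induction \<BB> D J rule: valid.induct)
  case (1 \<BB> D J)
  have arg: "is_argument D J" "is_argument D J'"
    using 1(4-6) by (auto simp: valid.simps[of \<BB> D J] is_argument_def)
  show ?case
  proof (cases "closed_structure D")
    case closed: True
    show ?thesis
    proof (cases "is_atomic (conclusion D)")
      case True
      then obtain D' where "reduces J D D'" "D' \<in> DER \<BB>"
        using 1(4) closed by (simp add: valid.simps[of \<BB> D]) blast
      then have "\<exists>D'. reduces J' D D' \<and> D' \<in> DER \<BB>" using reduces_mono[OF 1(5)] by blast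
      then show ?thesis using True arg closed by (simp add: valid.simps[of \<BB> D])
    next
      case False
      then obtain D' where D': "reduces J D D'" "canonical D'"
        "\<forall>E\<in>immediate_substructures D'. valid \<BB> E J"
        using 1(4) closed by (simp add: valid.simps[of \<BB> D]) blast
      have "\<forall>E\<in>immediate_substructures D'. valid \<BB> E J'"
        using 1(1)[OF arg(1) closed False D'(1,2)] D'(3) 1(5,6) by blast
      then have "\<exists>D'. reduces J' D D' \<and> canonical D' \<and>
          (\<forall>E\<in>immediate_substructures D'. valid \<BB> E J')"
        using D'(1,2) reduces_mono[OF 1(5)] by blast
      then show ?thesis using False arg closed by (simp add: valid.simps[of \<BB> D])
    qed
  next
    case False
    have "valid \<BB> (inst \<sigma> D) J''"
      if "J' \<subseteq> J''" "\<forall>\<phi>\<in>J''. reduction \<phi>" "substitution_for D \<sigma>"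
        "\<forall>A\<in>assumptions D. closed_structure (\<sigma> A) \<and> valid \<BB> (\<sigma> A) J''" for \<sigma> J''
    proof -
      have "J \<subseteq> J''" using that(1) 1(5) by blast
      then show ?thesis
        using 1(4) False that(2-4) by (simp add: valid.simps[of \<BB> D])
    qed
    then show ?thesis using False arg by (simp add: valid.simps[of \<BB> D])
  qed
qed

lemma valid_imp_is_argument: "valid \<BB> D J \<Longrightarrow> is_argument D J"
  by (simp add: valid.simps[of \<BB> D])

lemma reducibility_consequenceI:
  "valid \<BB> D J \<Longrightarrow> assumptions D = \<Gamma> \<Longrightarrow> conclusion D = A \<Longrightarrow> reducibility_consequence \<BB> \<Gamma> A"
  unfolding reducibility_consequence_def using valid_imp_is_argument by blast

lemma reducibility_consequence_cut:
  assumes "reducibility_consequence \<BB> \<Gamma> A" "\<forall>B\<in>\<Gamma>. reducibility_consequence \<BB> {} B"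
  shows "reducibility_consequence \<BB> {} A"
proof (cases "\<Gamma> = {}")
  case True
  then show ?thesis using assms(1) by simp
next
  case False
  obtain D J where D: "valid \<BB> D J" "assumptions D = \<Gamma>" "conclusion D = A"
    using assms(1) unfolding reducibility_consequence_def by blast
  obtain \<sigma> K where \<sigma>: "\<forall>B\<in>\<Gamma>. is_argument (\<sigma> B) (K B) \<and> assumptions (\<sigma> B) = {} \<and>
      conclusion (\<sigma> B) = B \<and> valid \<BB> (\<sigma> B) (K B)"
    using assms(2) unfolding reducibility_consequence_def by metis
  define J' where "J' = J \<union> (\<Union>B\<in>\<Gamma>. K B)"
  have J': "\<forall>\<phi>\<in>J'. reduction \<phi>"
    using valid_imp_is_argument[OF D(1)] \<sigma> by (auto simp: J'_def is_argument_def)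
  have sub: "substitution_for D \<sigma>"
    using \<sigma> D(2) by (auto simp: substitution_for_def is_argument_def)
  have closed: "\<forall>B\<in>assumptions D. closed_structure (\<sigma> B)"
    using \<sigma> D(2) by (simp add: closed_structure_iff)
  moreover have "valid \<BB> (\<sigma> B) J'" if "B \<in> assumptions D" for B
  proof (rule valid_mono[OF _ _ J'])
    show "valid \<BB> (\<sigma> B) (K B)" "K B \<subseteq> J'" using \<sigma> D(2) that by (auto simp: J'_def)
  qed
  moreover have "J \<subseteq> J'" by (simp add: J'_def)
  moreover have "\<not> closed_structure D" using False D(2) by (simp add: closed_structure_iff)
  ultimately have "valid \<BB> (inst \<sigma> D) J'"
    using D(1) J' sub by (simp add: valid.simps[of \<BB> D])
  moreover have "assumptions (inst \<sigma> D) = {}"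
    using closed_inst[OF closed] by (simp add: closed_structure_iff)
  moreover have "conclusion (inst \<sigma> D) = A"
    using conclusion_inst[OF sub] D(3) by simp
  ultimately show ?thesis by (rule reducibility_consequenceI)
qed

section \<open>Inversion of closed validity\<close>

lemma reducibility_consequence_atomD:
  assumes "reducibility_consequence \<BB> {} (At a)"
  shows "derivable \<BB> a"
proof -
  obtain D J where D: "is_argument D J" "assumptions D = {}" "conclusion D = At a" "valid \<BB> D J"
    using assms unfolding reducibility_consequence_def by blast
  then obtain D' where D': "reduces J D D'" "D' \<in> DER \<BB>"
    by (simp add: valid.simps[of \<BB> D] closed_structure_iff is_atomic_def) blast
  have "label (fst D') = At a"
    using reduces_conclusion_assumptions[OF D'(1)] D by (simp add: is_argument_def conclusion_def)
  moreover obtain f where "derivation (\<BB> \<times> {None}) f [] (fst D')"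
    using D'(2) by (auto simp: DER_def)
  then obtain b where "label (fst D') = At b" "derivable (fst ` (\<BB> \<times> {None :: node option})) b"
    using derivation_imp_derivable by blast
  ultimately show ?thesis by simp
qed

lemma conclusion_associated: "conclusion (associated (Ds, A, \<delta>)) = A"
  by (simp add: conclusion_def associated_def)

lemma closed_canonical_form:
  assumes "reducibility_consequence \<BB> {} A" "\<not> is_atomic A"
  obtains Ds \<delta> J where "inference (Ds, A, \<delta>)" "(Ds, A, \<delta>) \<in> con_intro \<union> dis_intro \<union> imp_intro"
    "closed_structure (associated (Ds, A, \<delta>))"
    "\<forall>E\<in>immediate_substructures (associated (Ds, A, \<delta>)). valid \<BB> E J"
proof -
  obtain D J where D: "is_argument D J" "assumptions D = {}" "conclusion D = A" "valid \<BB> D J"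
    using assms(1) unfolding reducibility_consequence_def by blast
  then obtain D' where D': "reduces J D D'" "canonical D'"
    "\<forall>E\<in>immediate_substructures D'. valid \<BB> E J"
    using assms(2) by (simp add: valid.simps[of \<BB> D] closed_structure_iff) blast
  have concl: "conclusion D' = A" and closed: "closed_structure D'"
    using reduces_conclusion_assumptions[OF D'(1)] D by (simp_all add: is_argument_def closed_structure_iff)
  obtain \<iota> where \<iota>: "D' = associated \<iota>" "\<iota> \<in> con_intro \<union> dis_intro \<union> imp_intro"
    using D'(2) unfolding canonical_def by blast
  obtain Ds \<delta> where \<iota>_eq: "\<iota> = (Ds, A, \<delta>)"
    using concl \<iota>(1) by (cases \<iota>) (simp add: conclusion_associated)
  have "inference \<iota>"
    using \<iota>(2) unfolding con_intro_def dis_intro_def imp_intro_def by blast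
  then show thesis using that D'(3) closed \<iota> \<iota>_eq by blast
qed

text \<open>
  In a closed structure an assumption of an immediate sub-structure is discharged at the root, and
  by the last inference itself rather than by the structures it was applied to. The set \<open>X\<close> bounds
  what that inference discharges: it is empty for conjunction and disjunction and consists of the
  antecedent for implication.
\<close>

lemma immediate_substructure_consequence:
  assumes "inference (Ds, A, \<delta>)" "closed_structure (associated (Ds, A, \<delta>))" "i < length Ds"
    and valid: "\<forall>E\<in>immediate_substructures (associated (Ds, A, \<delta>)). valid \<BB> E J"
    and X: "\<And>p q B. \<delta> p = Some q \<Longrightarrow> prior_discharge Ds p = None \<Longrightarrow>
      asm_at (fst (associated (Ds, A, \<delta>))) p B \<Longrightarrow> B \<in> X"
  shows "\<exists>\<Gamma>\<subseteq>X. reducibility_consequence \<BB> \<Gamma> (conclusion (Ds ! i))"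
proof -
  let ?E = "substructure (associated (Ds, A, \<delta>)) [i]"
  have "assumptions ?E \<subseteq> X"
  proof
    fix B assume "B \<in> assumptions ?E"
    then obtain p where p: "asm_at (fst (associated (Ds, A, \<delta>))) (i # p) B"
      "\<delta> (i # p) = None \<or> \<delta> (i # p) = Some [] \<and> prior_discharge Ds (i # p) = None"
      by (rule assumptions_substructure_associated[OF assms(1,3)])
    have "i # p \<in> dom \<delta>"
      using p(1) assms(2) unfolding closed_structure_def by (metis associated_def case_prod_conv snd_conv)
    then have "\<delta> (i # p) = Some []" "prior_discharge Ds (i # p) = None" using p(2) by auto
    then show "B \<in> X" using p(1) by (rule X)
  qed
  moreover have "reducibility_consequence \<BB> (assumptions ?E) (conclusion (Ds ! i))"
  proof (rule reducibility_consequenceI[OF _ refl])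
    have "?E \<in> immediate_substructures (associated (Ds, A, \<delta>))"
      using assms(3) by (auto simp: immediate_substructures_def associated_def)
    with valid show "valid \<BB> ?E J" ..
    show "conclusion ?E = conclusion (Ds ! i)"
      using assms(3) by (simp add: conclusion_def substructure_def associated_def)
  qed
  ultimately show ?thesis by (intro exI conjI)
qed

lemma reducibility_consequence_ConD:
  assumes "reducibility_consequence \<BB> {} (Con A B)"
  shows "reducibility_consequence \<BB> {} A" "reducibility_consequence \<BB> {} B"
proof -
  obtain Ds \<delta> J where D: "inference (Ds, Con A B, \<delta>)"
    "(Ds, Con A B, \<delta>) \<in> con_intro \<union> dis_intro \<union> imp_intro"
    "closed_structure (associated (Ds, Con A B, \<delta>))"
    "\<forall>E\<in>immediate_substructures (associated (Ds, Con A B, \<delta>)). valid \<BB> E J"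
    by (rule closed_canonical_form[OF assms]) (simp add: is_atomic_def)
  have "(Ds, Con A B, \<delta>) \<in> con_intro" using D(2) by (simp add: dis_intro_def imp_intro_def)
  then obtain D1 D2 where \<iota>: "Ds = [D1, D2]" "conclusion D1 = A" "conclusion D2 = B"
    "\<delta> = prior_discharge Ds"
    unfolding con_intro_def by blast
  have *: "\<exists>\<Gamma>\<subseteq>{}. reducibility_consequence \<BB> \<Gamma> (conclusion (Ds ! i))" if "i < 2" for i
    by (rule immediate_substructure_consequence[OF D(1,3) _ D(4)]) (use that in \<open>simp_all add: \<iota>(1,4)\<close>)
  show "reducibility_consequence \<BB> {} A" "reducibility_consequence \<BB> {} B"
    using *[of 0] *[of 1] \<iota>(1-3) by simp_all
qed

lemma reducibility_consequence_DisD: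
  assumes "reducibility_consequence \<BB> {} (Dis A B)"
  shows "reducibility_consequence \<BB> {} A \<or> reducibility_consequence \<BB> {} B"
proof -
  obtain Ds \<delta> J where D: "inference (Ds, Dis A B, \<delta>)"
    "(Ds, Dis A B, \<delta>) \<in> con_intro \<union> dis_intro \<union> imp_intro"
    "closed_structure (associated (Ds, Dis A B, \<delta>))"
    "\<forall>E\<in>immediate_substructures (associated (Ds, Dis A B, \<delta>)). valid \<BB> E J"
    by (rule closed_canonical_form[OF assms]) (simp add: is_atomic_def)
  have "(Ds, Dis A B, \<delta>) \<in> dis_intro" using D(2) by (simp add: con_intro_def imp_intro_def)
  then obtain D1 where \<iota>: "Ds = [D1]" "conclusion D1 = A \<or> conclusion D1 = B"
    "\<delta> = prior_discharge Ds"
    unfolding dis_intro_def by blast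
  have "\<exists>\<Gamma>\<subseteq>{}. reducibility_consequence \<BB> \<Gamma> (conclusion (Ds ! 0))"
    by (rule immediate_substructure_consequence[OF D(1,3) _ D(4)]) (simp_all add: \<iota>(1,3))
  then show ?thesis using \<iota>(1,2) by auto
qed

text \<open>
  The introduction rule may discharge vacuously, so that the argument for \<open>B\<close> may fail to have \<open>A\<close>
  among its assumptions; hence \<open>\<Gamma>\<close> in place of \<open>{A}\<close>.
\<close>

lemma reducibility_consequence_ImpD:
  assumes "reducibility_consequence \<BB> {} (Imp A B)"
  shows "\<exists>\<Gamma>\<subseteq>{A}. reducibility_consequence \<BB> \<Gamma> B"
proof -
  obtain Ds \<delta> J where D: "inference (Ds, Imp A B, \<delta>)"
    "(Ds, Imp A B, \<delta>) \<in> con_intro \<union> dis_intro \<union> imp_intro"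
    "closed_structure (associated (Ds, Imp A B, \<delta>))"
    "\<forall>E\<in>immediate_substructures (associated (Ds, Imp A B, \<delta>)). valid \<BB> E J"
    by (rule closed_canonical_form[OF assms]) (simp add: is_atomic_def)
  have "(Ds, Imp A B, \<delta>) \<in> imp_intro" using D(2) by (simp add: con_intro_def dis_intro_def)
  then obtain D1 where \<iota>: "Ds = [D1]" "conclusion D1 = B"
    "\<And>p q. \<delta> p = Some q \<Longrightarrow> prior_discharge Ds p = None \<Longrightarrow>
       asm_at (fst (associated (Ds, Imp A B, \<delta>))) p A"
    unfolding imp_intro_def by blast
  have "\<exists>\<Gamma>\<subseteq>{A}. reducibility_consequence \<BB> \<Gamma> (conclusion (Ds ! 0))"
  proof (rule immediate_substructure_consequence[OF D(1,3) _ D(4)])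
    fix p q C
    assume "\<delta> p = Some q" "prior_discharge Ds p = None"
      and C: "asm_at (fst (associated (Ds, Imp A B, \<delta>))) p C"
    then have "asm_at (fst (associated (Ds, Imp A B, \<delta>))) p A" using \<iota>(3) by blast
    then show "C \<in> {A}" using C by (simp add: asm_at_def)
  qed (simp add: \<iota>(1))
  then show ?thesis using \<iota>(1,2) by simp
qed

section \<open>Soundness from completeness\<close>

lemma reducibility_imp_sandqvist_valid:
  assumes complete: "\<And>A. sandqvist_valid \<BB> A \<Longrightarrow> reducibility_consequence \<BB> {} A"
  shows "reducibility_consequence \<BB> {} A \<Longrightarrow> sandqvist_valid \<BB> A"
proof (induction A)
  case (At a)
  then show ?case by (simp add: reducibility_consequence_atomD)
next
  case (Con A B)
  then show ?case using reducibility_consequence_ConD[OF Con.prems] by simp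
next
  case (Dis A B)
  then have "sandqvist_valid \<BB> A \<or> sandqvist_valid \<BB> B"
    using reducibility_consequence_DisD[OF Dis.prems] by blast
  then show ?case by auto
next
  case (Imp A B)
  have "sandqvist_valid \<BB> B" if "sandqvist_valid \<BB> A"
  proof -
    obtain \<Gamma> where \<Gamma>: "\<Gamma> \<subseteq> {A}" "reducibility_consequence \<BB> \<Gamma> B"
      using reducibility_consequence_ImpD[OF Imp.prems] by blast
    moreover have "\<forall>C\<in>\<Gamma>. reducibility_consequence \<BB> {} C"
      using complete[OF that] \<Gamma>(1) by blast
    ultimately have "reducibility_consequence \<BB> {} B" by (intro reducibility_consequence_cut)
    then show ?thesis by (rule Imp.IH(2))
  qed
  then show ?case by simp
qed

theorem theorem4:
  fixes \<BB> :: "rule set"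
  assumes "atomic_base \<BB>"
    and "\<forall>\<Gamma> A. finite \<Gamma> \<longrightarrow> sandqvist_consequence \<BB> \<Gamma> A \<longrightarrow> reducibility_consequence \<BB> \<Gamma> A"
  shows "\<forall>\<Gamma> A. finite \<Gamma> \<longrightarrow> reducibility_consequence \<BB> \<Gamma> A \<longrightarrow> sandqvist_consequence \<BB> \<Gamma> A"
proof (intro allI impI)
  fix \<Gamma> A
  assume \<Gamma>: "reducibility_consequence \<BB> \<Gamma> A"
  have complete: "reducibility_consequence \<BB> {} B" if "sandqvist_valid \<BB> B" for B
    using assms(2) that by (simp add: sandqvist_consequence_def)
  have "sandqvist_valid \<BB> A" if "\<forall>B\<in>\<Gamma>. sandqvist_valid \<BB> B"
  proof (rule reducibility_imp_sandqvist_valid[OF complete])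
    show "reducibility_consequence \<BB> {} A"
      using that complete by (intro reducibility_consequence_cut[OF \<Gamma>]) simp
  qed
  then show "sandqvist_consequence \<BB> \<Gamma> A"
    by (simp add: sandqvist_consequence_def)
qed

end
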